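(* Let $1<\alpha\le 2$, $\eta\in(0,1)$, $\beta>0$, let $f:[0,1]\times\mathbb{R}\to[0,\infty)$ be continuous, and let $H_1,H_2:C[0,1]\to[0,\infty)$ be compact functionals. Suppose that one of the following three cases holds, and let $i\in\{1,2,3\}$ be its number: Case 1: $\beta>\max\{\beta_K,\beta_\gamma\}$, with $b=1$; Case 2: $\beta=\max\{\beta_K,\beta_\gamma\}$, with a fixed $b\in[\eta,1)$; Case 3: $\beta<\min\{\beta_K,\beta_\gamma\}$, with a fixed $b\in[\eta,t^* )$. Let $\rho>0$ and assume that: (1) there exists $\underline{\delta}_\rho\in C([0,b],\mathbb{R}^+)$ such that $f(t,u)\ge\underline{\delta}_\rho(t)$ for all $(t,u)\in[0,b]\times[\sigma_i\rho,\rho]$; (2) there exist $\underline{\eta}_{1,\rho},\underline{\eta}_{2,\rho}\ge0$ such that $H_1[u]\ge\underline{\eta}_{1,\rho}$ and $H_2[u]\ge\underline{\eta}_{2,\rho}$ for every $u\in P_{\sigma_i}\cap\partial\Omega_\rho$; (3) $\gamma(0)\,\underline{\eta}_{1,\rho}+\underline{\eta}_{2,\rho}+\int_0^bK(0,s)\,\underline{\delta}_\rho(s)\,ds>0$; and let $(u_\rho,\lambda_\rho)$ be an eigenpair (whose existence is guaranteed under these hypotheses) with $\lambda_\rho>0$, $u_\rho\in P_{\sigma_i}$, $\|u_\rho\|_\infty=\rho$ and $u_\rho=\lambda_\rho T(u_\rho)$. In addition assume that: (4) there exists $\overline{\delta}_\rho\in C([0,1],\mathbb{R}^+)$ such that $f(t,u)\le\overline{\delta}_\rho(t)$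 for every $t\in[0,1]$ and every $u\in[\tau_i\rho,\rho]$, where $\tau_1=\sigma_1$, $\tau_2=0$, $\tau_3=-1$; (5) there are constants $\overline{\eta}_{1,\rho},\overline{\eta}_{2,\rho}$ such that $H_1[u]\le\overline{\eta}_{1,\rho}$ and $H_2[u]\le\overline{\eta}_{2,\rho}$ for every $u\in P_{\sigma_i}\cap\partial\Omega_\rho$. Then $\lambda_\rho\in[L(\rho),U(\rho)]$, where $$L(\rho)=\frac{\rho}{\overline{\eta}_{1,\rho}\|\gamma\|_\infty+\overline{\eta}_{2,\rho}+\int_0^1\Phi(s)\overline{\delta}_\rho(s)\,ds},\qquad U(\rho)=\frac{\rho}{\underline{\eta}_{1,\rho}\gamma(0)+\underline{\eta}_{2,\rho}+\int_0^bK(0,s)\underline{\delta}_\rho(s)\,ds}.$$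
   Context: $C[0,1]$ carries the supremum norm $\|\cdot\|_\infty$; $\Omega_\rho=\{u\in C[0,1]:\|u\|_\infty<\rho\}$, with boundary $\partial\Omega_\rho=\{u:\|u\|_\infty=\rho\}$. $\mathbb{R}^+=[0,\infty)$. $\Gamma$ is the Gamma function. "Compact" means continuous and mapping bounded sets to relatively compact sets; $H_1,H_2$ need not be linear. For $t,s\in[0,1]$ put $$\gamma(t)=\frac{\beta}{\Gamma(3-\alpha)}+\eta-t,\qquad K(t,s)=\beta+\frac{(\eta-s)^{\alpha-1}}{\Gamma(\alpha)}\chi_{[0,\eta]}(s)-\frac{(t-s)^{\alpha-1}}{\Gamma(\alpha)}\chi_{[0,t]}(s),$$ where $\chi_A$ is the characteristic function of $A$ (the corresponding term is $0$ when $s\notin A$), and for $u\in C[0,1]$ $$T(u)(t)=H_1[u]\gamma(t)+H_2[u]+\int_0^1K(t,s)f(s,u(s))\,ds .$$ The equation $u=\lambda T(u)$ is the mild formulation of the boundary value problem ${}^{C}D^{\alpha}u(t)+\lambda f(t,u(t))=0$ on $(0,1)$, $u'(0)+\lambda H_1[u]=0$, $\beta\,{}^{C}D^{\alpha-1}u(1)+u(\eta)=\lambda H_2[u]$, with ${}^{C}D$ the Caputo derivative; an eigenpair is a pair $(u,\lambda)$ satisfying $u=\lambda T(u)$. Thresholds: $\beta_K=\frac{(1-\eta)^{\alpha-1}}{\Gamma(\alpha)}$, $\beta_\gamma=(1-\eta)\Gamma(3-\alpha)$, and $t^*=\min\{t_K,t_\gamma\}$ with $t_K=\eta+(\beta\Gamma(\alpha))^{1/(\alpha-1)}$,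 $t_\gamma=\eta+\frac{\beta}{\Gamma(3-\alpha)}$. The function $\Phi$ is constant in $s$: in Cases 1 and 2, $\Phi(s)=\beta+\frac{\eta^{\alpha-1}}{\Gamma(\alpha)}$; in Case 3, $$\Phi(s)=\max\left\{\frac{\beta\Gamma(\alpha)+\eta^{\alpha-1}}{\Gamma(\alpha)},\ \frac{(1-\eta)^{\alpha-1}-\beta\Gamma(\alpha)}{\Gamma(\alpha)}\right\}.$$ Constants: $\sigma_i=\min\{\sigma_{i,\gamma},1,c_{i,K}\}$ for $i=1,2,3$, where $$c_{1,K}=\frac{\beta\Gamma(\alpha)-(1-\eta)^{\alpha-1}}{\beta\Gamma(\alpha)+\eta^{\alpha-1}},\qquad c_{2,K}=\frac{\beta\Gamma(\alpha)-(b-\eta)^{\alpha-1}}{\beta\Gamma(\alpha)+\eta^{\alpha-1}},$$ $$c_{3,K}=\min\left\{\frac{\beta\Gamma(\alpha)-(b-\eta)^{\alpha-1}}{\beta\Gamma(\alpha)+\eta^{\alpha-1}},\ \frac{\beta\Gamma(\alpha)-(b-\eta)^{\alpha-1}}{(1-\eta)^{\alpha-1}-\beta\Gamma(\alpha)}\right\},$$ $$\sigma_{1,\gamma}=\frac{\beta+(\eta-1)\Gamma(3-\alpha)}{\beta+\eta\Gamma(3-\alpha)},\qquad \sigma_{2,\gamma}=\frac{\beta+(\eta-b)\Gamma(3-\alpha)}{\beta+\eta\Gamma(3-\alpha)},$$ $$\sigma_{3,\gamma}=\frac{\beta+(\eta-b)\Gamma(3-\alpha)}{\max\{\beta+\eta\Gamma(3-\alpha),\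 (1-\eta)\Gamma(3-\alpha)-\beta\}}.$$ Cones: $$P_{\sigma_1}=\{u\in C[0,1]:\min_{t\in[0,1]}u(t)\ge\sigma_1\|u\|_\infty\},$$ $$P_{\sigma_2}=\{u\in C[0,1]:u\ge0\text{ on }[0,1],\ \min_{t\in[0,b]}u(t)\ge\sigma_2\|u\|_\infty\},$$ $$P_{\sigma_3}=\{u\in C[0,1]:\min_{t\in[0,b]}u(t)\ge\sigma_3\|u\|_\infty\}.$$ *)

theory Defs
  imports "HOL-Analysis.Analysis"
begin

text \<open>The metric space \<open>C[0,1]\<close>. Its points are the continuous functions on \<open>{0..1}\<close>,
  represented extensionally (equal to \<open>undefined\<close> outside \<open>{0..1}\<close>), so that functionals
  on \<open>mspace C01\<close> see nothing but the values on \<open>[0,1]\<close>.\<close>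

definition C01 :: "(real \<Rightarrow> real) metric" where
  "C01 = cfunspace (top_of_set {0..1}) euclidean_metric"

definition supnorm :: "(real \<Rightarrow> real) \<Rightarrow> real" where
  "supnorm u = (SUP t\<in>{0..1}. \<bar>u t\<bar>)"

lemma mspace_C01:
  "u \<in> mspace C01 \<longleftrightarrow> u \<in> extensional {0..1} \<and> continuous_on {0..1} u"
proof -
  have "compactin (top_of_set {0..1::real}) (topspace (top_of_set {0..1}))"
    by (simp add: compactin_subtopology)
  then show ?thesis
    unfolding C01_def by (subst compactin_mspace_cfunspace) auto
qed

lemma mdist_C01:
  assumes "u \<in> mspace C01" and "v \<in> mspace C01"
  shows "mdist C01 u v = supnorm (\<lambda>t. u t - v t)"
proof -
  have "u \<in> mspace (funspace {0..1} euclidean_metric)"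
       "v \<in> mspace (funspace {0..1} euclidean_metric)"
    using assms cfunspace_subset_funspace[of "top_of_set {0..1::real}" euclidean_metric]
    unfolding C01_def by auto
  then show ?thesis
    unfolding C01_def mdist_cfunspace_eq_mdist_funspace supnorm_def
    by (simp add: Met_TC.fdist_def dist_real_def)
qed

definition sphere_C01 :: "real \<Rightarrow> (real \<Rightarrow> real) set" where
  "sphere_C01 \<rho> = {u \<in> mspace C01. supnorm u = \<rho>}"

definition compact_functional :: "((real \<Rightarrow> real) \<Rightarrow> real) \<Rightarrow> bool" where
  "compact_functional H \<longleftrightarrow>
     continuous_map (mtopology_of C01) euclideanreal H \<and>
     (\<forall>A. Metric_space.mbounded (mspace C01) (mdist C01) A \<longrightarrow> compact (closure (H ` A)))"

definition gam :: "real \<Rightarrow> real \<Rightarrow> real \<Rightarrow> real \<Rightarrow> real" where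
  "gam \<alpha> \<eta> \<beta> t = \<beta> / Gamma (3 - \<alpha>) + \<eta> - t"

text \<open>The indicators annihilate the terms in which \<open>powr\<close> has a negative base.\<close>

definition K :: "real \<Rightarrow> real \<Rightarrow> real \<Rightarrow> real \<Rightarrow> real \<Rightarrow> real" where
  "K \<alpha> \<eta> \<beta> t s =
     \<beta> + (\<eta> - s) powr (\<alpha> - 1) / Gamma \<alpha> * indicator {0..\<eta>} s
       - (t - s) powr (\<alpha> - 1) / Gamma \<alpha> * indicator {0..t} s"

definition T ::
  "real \<Rightarrow> real \<Rightarrow> real \<Rightarrow> (real \<Rightarrow> real \<Rightarrow> real) \<Rightarrow>
   ((real \<Rightarrow> real) \<Rightarrow> real) \<Rightarrow> ((real \<Rightarrow> real) \<Rightarrow> real) \<Rightarrow>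
   (real \<Rightarrow> real) \<Rightarrow> real \<Rightarrow> real" where
  "T \<alpha> \<eta> \<beta> f H1 H2 u =
     (\<lambda>t\<in>{0..1}. H1 u * gam \<alpha> \<eta> \<beta> t + H2 u
        + integral {0..1} (\<lambda>s. K \<alpha> \<eta> \<beta> t s * f s (u s)))"

definition eigenpair ::
  "real \<Rightarrow> real \<Rightarrow> real \<Rightarrow> (real \<Rightarrow> real \<Rightarrow> real) \<Rightarrow>
   ((real \<Rightarrow> real) \<Rightarrow> real) \<Rightarrow> ((real \<Rightarrow> real) \<Rightarrow> real) \<Rightarrow>
   (real \<Rightarrow> real) \<Rightarrow> real \<Rightarrow> bool" where
  "eigenpair \<alpha> \<eta> \<beta> f H1 H2 u lam \<longleftrightarrow>
     u \<in> mspace C01 \<and> u = (\<lambda>t\<in>{0..1}. lam * T \<alpha> \<eta> \<beta> f H1 H2 u t)"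

definition beta_K :: "real \<Rightarrow> real \<Rightarrow> real" where
  "beta_K \<alpha> \<eta> = (1 - \<eta>) powr (\<alpha> - 1) / Gamma \<alpha>"

definition beta_gam :: "real \<Rightarrow> real \<Rightarrow> real" where
  "beta_gam \<alpha> \<eta> = (1 - \<eta>) * Gamma (3 - \<alpha>)"

definition t_star :: "real \<Rightarrow> real \<Rightarrow> real \<Rightarrow> real" where
  "t_star \<alpha> \<eta> \<beta> =
     min (\<eta> + (\<beta> * Gamma \<alpha>) powr (1 / (\<alpha> - 1))) (\<eta> + \<beta> / Gamma (3 - \<alpha>))"

datatype regime = Case1 | Case2 | Case3

fun Phi :: "regime \<Rightarrow> real \<Rightarrow> real \<Rightarrow> real \<Rightarrow> real \<Rightarrow> real" where
  "Phi Case1 \<alpha> \<eta> \<beta> s = \<beta> + \<eta> powr (\<alpha> - 1) / Gamma \<alpha>"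
| "Phi Case2 \<alpha> \<eta> \<beta> s = \<beta> + \<eta> powr (\<alpha> - 1) / Gamma \<alpha>"
| "Phi Case3 \<alpha> \<eta> \<beta> s =
     max ((\<beta> * Gamma \<alpha> + \<eta> powr (\<alpha> - 1)) / Gamma \<alpha>)
         (((1 - \<eta>) powr (\<alpha> - 1) - \<beta> * Gamma \<alpha>) / Gamma \<alpha>)"

fun c_K :: "regime \<Rightarrow> real \<Rightarrow> real \<Rightarrow> real \<Rightarrow> real \<Rightarrow> real" where
  "c_K Case1 \<alpha> \<eta> \<beta> b =
     (\<beta> * Gamma \<alpha> - (1 - \<eta>) powr (\<alpha> - 1)) / (\<beta> * Gamma \<alpha> + \<eta> powr (\<alpha> - 1))"
| "c_K Case2 \<alpha> \<eta> \<beta> b =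
     (\<beta> * Gamma \<alpha> - (b - \<eta>) powr (\<alpha> - 1)) / (\<beta> * Gamma \<alpha> + \<eta> powr (\<alpha> - 1))"
| "c_K Case3 \<alpha> \<eta> \<beta> b =
     min ((\<beta> * Gamma \<alpha> - (b - \<eta>) powr (\<alpha> - 1)) / (\<beta> * Gamma \<alpha> + \<eta> powr (\<alpha> - 1)))
         ((\<beta> * Gamma \<alpha> - (b - \<eta>) powr (\<alpha> - 1)) / ((1 - \<eta>) powr (\<alpha> - 1) - \<beta> * Gamma \<alpha>))"

fun sigma_gam :: "regime \<Rightarrow> real \<Rightarrow> real \<Rightarrow> real \<Rightarrow> real \<Rightarrow> real" where
  "sigma_gam Case1 \<alpha> \<eta> \<beta> b =
     (\<beta> + (\<eta> - 1) * Gamma (3 - \<alpha>)) / (\<beta> + \<eta> * Gamma (3 - \<alpha>))"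
| "sigma_gam Case2 \<alpha> \<eta> \<beta> b =
     (\<beta> + (\<eta> - b) * Gamma (3 - \<alpha>)) / (\<beta> + \<eta> * Gamma (3 - \<alpha>))"
| "sigma_gam Case3 \<alpha> \<eta> \<beta> b =
     (\<beta> + (\<eta> - b) * Gamma (3 - \<alpha>))
       / max (\<beta> + \<eta> * Gamma (3 - \<alpha>)) ((1 - \<eta>) * Gamma (3 - \<alpha>) - \<beta>)"

definition sigma_const :: "regime \<Rightarrow> real \<Rightarrow> real \<Rightarrow> real \<Rightarrow> real \<Rightarrow> real" where
  "sigma_const i \<alpha> \<eta> \<beta> b = min (sigma_gam i \<alpha> \<eta> \<beta> b) (min 1 (c_K i \<alpha> \<eta> \<beta> b))"

text \<open>The infima below are minima, as \<open>u\<close> is continuous on a nonempty compact interval.\<close>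

fun P_cone :: "regime \<Rightarrow> real \<Rightarrow> real \<Rightarrow> real \<Rightarrow> real \<Rightarrow> (real \<Rightarrow> real) set" where
  "P_cone Case1 \<alpha> \<eta> \<beta> b =
     {u \<in> mspace C01. (INF t\<in>{0..1}. u t) \<ge> sigma_const Case1 \<alpha> \<eta> \<beta> b * supnorm u}"
| "P_cone Case2 \<alpha> \<eta> \<beta> b =
     {u \<in> mspace C01. (\<forall>t\<in>{0..1}. u t \<ge> 0) \<and>
        (INF t\<in>{0..b}. u t) \<ge> sigma_const Case2 \<alpha> \<eta> \<beta> b * supnorm u}"
| "P_cone Case3 \<alpha> \<eta> \<beta> b =
     {u \<in> mspace C01. (INF t\<in>{0..b}. u t) \<ge> sigma_const Case3 \<alpha> \<eta> \<beta> b * supnorm u}"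

fun tau :: "regime \<Rightarrow> real \<Rightarrow> real \<Rightarrow> real \<Rightarrow> real \<Rightarrow> real" where
  "tau Case1 \<alpha> \<eta> \<beta> b = sigma_const Case1 \<alpha> \<eta> \<beta> b"
| "tau Case2 \<alpha> \<eta> \<beta> b = 0"
| "tau Case3 \<alpha> \<eta> \<beta> b = -1"

end

theory Submission
  imports Defs
begin

text \<open>An eigenpair satisfies \<open>u(t) = \<lambda> T(u)(t)\<close> for every \<open>t\<close>, so bounds on \<open>T(u)\<close> translate into
  bounds on \<open>\<lambda> = \<rho> / \<parallel>T(u)\<parallel>\<close>.

  For the upper bound on \<open>\<lambda>\<close> the identity is read off at \<open>t = 0\<close>, where the negative term of
  the kernel vanishes. Hence \<open>K(0,s) \<ge> 0\<close> and, as \<open>f \<ge> 0\<close>, the part of the integral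
  over \<open>[b,1]\<close> may be discarded; on \<open>[0,b]\<close> the cone condition keeps \<open>u\<close> in \<open>[\<sigma>\<rho>, \<rho>]\<close>, where the lower bound
  on \<open>f\<close> is available. This bounds \<open>\<rho> \<ge> u(0)\<close> from below by \<open>\<lambda>\<close> times the denominator of \<open>U(\<rho>)\<close>.

  For the lower bound, \<open>\<bar>K(t,s)\<bar> \<le> \<Phi>(s)\<close> (lemma \<open>abs_K_le_Phi\<close>) gives \<open>\<bar>T(u)(t)\<bar>\<close> at most the
  denominator of \<open>L(\<rho>)\<close> for all \<open>t\<close>, so \<open>\<rho> = \<parallel>u\<parallel>\<close> is at most \<open>\<lambda>\<close> times that denominator.
  The kernel estimate is the one analytic ingredient: because \<open>0 < \<alpha> - 1 \<le> 1\<close>, the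
  power \<open>x \<mapsto> x\<^sup>\<alpha>\<^sup>-\<^sup>1\<close> is subadditive, which bounds the difference of the two power terms of \<open>K\<close>
  below by \<open>-(1-\<eta>)\<^sup>\<alpha>\<^sup>-\<^sup>1\<close> uniformly in \<open>t\<close> and \<open>s\<close>; the regime of \<open>\<beta>\<close> then decides how this
  compares with \<open>\<Phi>\<close>.\<close>

section \<open>Bounds for the kernel\<close>

text \<open>After normalising to \<open>x + y = 1\<close> both summands lie in \<open>[0,1]\<close>, where a power with
  exponent at most 1 dominates the identity.\<close>

lemma powr_subadditive:
  fixes x y c :: real
  assumes "0 \<le> x" "0 \<le> y" "0 < c" "c \<le> 1"
  shows "(x + y) powr c \<le> x powr c + y powr c"
proof (cases "x + y = 0")
  case False
  then have pos: "0 < x + y" using assms by linarith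
  have dominate: "z \<le> z powr c" if "0 \<le> z" "z \<le> 1" for z :: real
    using powr_mono'[of c 1 z] that assms by simp
  have "1 = x / (x + y) + y / (x + y)"
    using pos by (simp add: add_divide_distrib[symmetric])
  also have "\<dots> \<le> (x / (x + y)) powr c + (y / (x + y)) powr c"
    using assms pos by (intro add_mono dominate) auto
  also have "\<dots> = (x powr c + y powr c) / (x + y) powr c"
    using assms pos by (simp add: powr_divide add_divide_distrib)
  finally show ?thesis using pos by (simp add: le_divide_eq)
qed simp

text \<open>Replacing the indicators by positive parts exhibits both power terms as continuous and monotone
  functions of \<open>s\<close>.\<close>

lemma K_positive_part:
  assumes "0 \<le> s"
  shows "K \<alpha> \<eta> \<beta> t s =
    \<beta> + (max 0 (\<eta> - s) powr (\<alpha> - 1) - max 0 (t - s) powr (\<alpha> - 1)) / Gamma \<alpha>"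
  using assms unfolding K_def
  by (auto simp: indicator_def max_def diff_divide_distrib)

lemma continuous_on_K:
  assumes "1 < \<alpha>" "S \<subseteq> {0..}"
  shows "continuous_on S (K \<alpha> \<eta> \<beta> t)"
proof -
  have "continuous_on S (\<lambda>s. \<beta> + (max 0 (\<eta> - s) powr (\<alpha> - 1)
      - max 0 (t - s) powr (\<alpha> - 1)) * inverse (Gamma \<alpha>))"
    using assms by (intro continuous_intros continuous_on_powr') auto
  then show ?thesis
    by (rule continuous_on_eq) (use assms in \<open>auto simp: K_positive_part divide_inverse\<close>)
qed

lemma K_0_nonneg:
  assumes "0 < \<beta>" "1 < \<alpha>" "0 \<le> s"
  shows "0 \<le> K \<alpha> \<eta> \<beta> 0 s"
  using assms Gamma_real_pos[of \<alpha>] by (simp add: K_positive_part max_def)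

lemma K_le:
  assumes "1 < \<alpha>" "0 < \<eta>" "0 \<le> s"
  shows "K \<alpha> \<eta> \<beta> t s \<le> \<beta> + \<eta> powr (\<alpha> - 1) / Gamma \<alpha>"
proof -
  have "max 0 (\<eta> - s) powr (\<alpha> - 1) \<le> \<eta> powr (\<alpha> - 1)"
    using assms by (intro powr_mono2) auto
  moreover have "0 \<le> max 0 (t - s) powr (\<alpha> - 1)" by simp
  ultimately have "max 0 (\<eta> - s) powr (\<alpha> - 1) - max 0 (t - s) powr (\<alpha> - 1) \<le> \<eta> powr (\<alpha> - 1)"
    by linarith
  moreover have "0 < Gamma \<alpha>" using assms by (intro Gamma_real_pos) simp
  ultimately have "(max 0 (\<eta> - s) powr (\<alpha> - 1) - max 0 (t - s) powr (\<alpha> - 1)) / Gamma \<alpha>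
      \<le> \<eta> powr (\<alpha> - 1) / Gamma \<alpha>"
    by (intro divide_right_mono) auto
  then show ?thesis using assms by (simp add: K_positive_part)
qed

text \<open>The positive part of \<open>t - s\<close> is at most that of \<open>\<eta> - s\<close> plus \<open>1 - \<eta>\<close>, so
  subadditivity controls the negative term by the positive one.\<close>

lemma K_ge:
  assumes "1 < \<alpha>" "\<alpha> \<le> 2" "\<eta> < 1" "t \<le> 1" "0 \<le> s"
  shows "\<beta> - (1 - \<eta>) powr (\<alpha> - 1) / Gamma \<alpha> \<le> K \<alpha> \<eta> \<beta> t s"
proof -
  have "max 0 (t - s) powr (\<alpha> - 1) \<le> (max 0 (\<eta> - s) + (1 - \<eta>)) powr (\<alpha> - 1)"
    using assms by (intro powr_mono2) auto
  also have "\<dots> \<le> max 0 (\<eta> - s) powr (\<alpha> - 1) + (1 - \<eta>) powr (\<alpha> - 1)"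
    using assms by (intro powr_subadditive) auto
  finally have "- ((1 - \<eta>) powr (\<alpha> - 1)) \<le>
      max 0 (\<eta> - s) powr (\<alpha> - 1) - max 0 (t - s) powr (\<alpha> - 1)"
    by simp
  moreover have "0 < Gamma \<alpha>" using assms by (intro Gamma_real_pos) simp
  ultimately have "- ((1 - \<eta>) powr (\<alpha> - 1)) / Gamma \<alpha> \<le>
      (max 0 (\<eta> - s) powr (\<alpha> - 1) - max 0 (t - s) powr (\<alpha> - 1)) / Gamma \<alpha>"
    by (intro divide_right_mono) auto
  then show ?thesis using assms by (simp add: K_positive_part)
qed

text \<open>In the first two regimes \<open>\<beta> \<ge> \<beta>\<^sub>K\<close> makes the kernel nonnegative, so \<open>\<Phi>\<close> need only
  dominate its maximum; in the third the kernel changes sign and the second entry of the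
  maximum defining \<open>\<Phi>\<close> takes care of \<open>-K\<close>.\<close>

lemma abs_K_le_Phi:
  assumes "1 < \<alpha>" "\<alpha> \<le> 2" "0 < \<eta>" "\<eta> < 1" "t \<le> 1" "0 \<le> s"
    and regime: "i = Case3 \<or> beta_K \<alpha> \<eta> \<le> \<beta>"
  shows "\<bar>K \<alpha> \<eta> \<beta> t s\<bar> \<le> Phi i \<alpha> \<eta> \<beta> s"
proof -
  have upper: "K \<alpha> \<eta> \<beta> t s \<le> \<beta> + \<eta> powr (\<alpha> - 1) / Gamma \<alpha>"
    using assms by (intro K_le) auto
  have lower: "\<beta> - beta_K \<alpha> \<eta> \<le> K \<alpha> \<eta> \<beta> t s"
    using K_ge[of \<alpha> \<eta> t s \<beta>] assms by (simp add: beta_K_def)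
  have "0 < Gamma \<alpha>" using assms by (intro Gamma_real_pos) simp
  then have Phi3: "Phi Case3 \<alpha> \<eta> \<beta> s =
      max (\<beta> + \<eta> powr (\<alpha> - 1) / Gamma \<alpha>) (beta_K \<alpha> \<eta> - \<beta>)"
    by (simp add: beta_K_def add_divide_distrib diff_divide_distrib)
  show ?thesis
  proof (cases i)
    case Case3
    then show ?thesis
      unfolding Case3 Phi3 using upper lower by linarith
  qed (use upper lower regime in auto)
qed

section \<open>Pointwise bounds on functions in the cones\<close>

lemma abs_le_supnorm:
  assumes "continuous_on {0..1} u" "t \<in> {0..1}"
  shows "\<bar>u t\<bar> \<le> supnorm u"
proof -
  have "bdd_above ((\<lambda>t. \<bar>u t\<bar>) ` {0..1})"
    using assms by (intro bounded_imp_bdd_above compact_imp_bounded compact_continuous_image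
        continuous_intros) auto
  then show ?thesis unfolding supnorm_def using assms by (intro cSUP_upper) auto
qed

lemma supnorm_le:
  assumes "\<And>t. t \<in> {0..1} \<Longrightarrow> \<bar>u t\<bar> \<le> M"
  shows "supnorm u \<le> M"
  unfolding supnorm_def using assms by (intro cSUP_least) auto

lemma INF_le_value:
  fixes u :: "real \<Rightarrow> real"
  assumes "continuous_on {a..b} u" "t \<in> {a..b}"
  shows "(INF t\<in>{a..b}. u t) \<le> u t"
  using assms
  by (intro cINF_lower bounded_imp_bdd_below compact_imp_bounded compact_continuous_image) auto

lemma P_cone_continuous:
  assumes "u \<in> P_cone i \<alpha> \<eta> \<beta> b"
  shows "continuous_on {0..1} u"
  using assms by (cases i) (auto simp: mspace_C01)

lemma P_cone_value_ge:
  assumes u: "u \<in> P_cone i \<alpha> \<eta> \<beta> b" and "b \<le> 1" and t: "t \<in> {0..b}"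
  shows "sigma_const i \<alpha> \<eta> \<beta> b * supnorm u \<le> u t"
proof -
  have cont: "continuous_on {0..1} u" using u by (rule P_cone_continuous)
  have "continuous_on {0..b} u"
    by (rule continuous_on_subset[OF cont]) (use assms in auto)
  then have "(INF t\<in>{0..b}. u t) \<le> u t" using t by (rule INF_le_value)
  moreover have "(INF t\<in>{0..1}. u t) \<le> u t" using cont assms by (intro INF_le_value) auto
  ultimately show ?thesis using u by (cases i) auto
qed

text \<open>This explains the left endpoints \<open>\<tau>\<^sub>i \<rho>\<close>: they are the lower bounds on all of \<open>[0,1]\<close> that
  membership in the three cones leaves; beyond \<open>b\<close> only the sign of \<open>u\<close> (second cone) or
  nothing but its norm (third cone) is controlled.\<close>

lemma P_cone_value_ge_tau:
  assumes u: "u \<in> P_cone i \<alpha> \<eta> \<beta> b" and t: "t \<in> {0..1}"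
  shows "tau i \<alpha> \<eta> \<beta> b * supnorm u \<le> u t"
proof (cases i)
  case Case1
  have "(INF t\<in>{0..1}. u t) \<le> u t"
    using P_cone_continuous[OF u] t by (rule INF_le_value)
  then show ?thesis using u Case1 by simp
next
  case Case2
  then show ?thesis using u t by simp
next
  case Case3
  then show ?thesis using abs_le_supnorm[OF P_cone_continuous[OF u] t] by simp
qed

section \<open>Localization of the eigenvalue\<close>

lemma eigenpair_value:
  assumes "eigenpair \<alpha> \<eta> \<beta> f H1 H2 u lam" "t \<in> {0..1}"
  shows "u t = lam * (H1 u * gam \<alpha> \<eta> \<beta> t + H2 u
    + integral {0..1} (\<lambda>s. K \<alpha> \<eta> \<beta> t s * f s (u s)))"
proof -
  have "u = (\<lambda>t\<in>{0..1}. lam * T \<alpha> \<eta> \<beta> f H1 H2 u t)"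
    using assms unfolding eigenpair_def by simp
  then have "u t = (\<lambda>t\<in>{0..1}. lam * T \<alpha> \<eta> \<beta> f H1 H2 u t) t" by (rule fun_cong)
  also have "\<dots> = lam * T \<alpha> \<eta> \<beta> f H1 H2 u t" using assms by simp
  finally show ?thesis using assms unfolding T_def by simp
qed

lemma continuous_on_superposition:
  fixes f :: "real \<Rightarrow> real \<Rightarrow> real"
  assumes "continuous_on (S \<times> UNIV) (\<lambda>(t, x). f t x)" "continuous_on S u"
  shows "continuous_on S (\<lambda>s. f s (u s))"
proof -
  have "continuous_on S (\<lambda>s. (\<lambda>(t, x). f t x) (s, u s))"
    by (rule continuous_on_compose2[OF assms(1)]) (use assms in \<open>auto intro: continuous_intros\<close>)
  then show ?thesis by simp
qed

theorem theorem4p1: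
  fixes \<alpha> \<eta> \<beta> b \<rho> lam eta1_lo eta2_lo eta1_up eta2_up :: real
    and f :: "real \<Rightarrow> real \<Rightarrow> real"
    and H1 H2 :: "(real \<Rightarrow> real) \<Rightarrow> real"
    and delta_lo delta_up u\<^sub>\<rho> :: "real \<Rightarrow> real"
    and i :: regime
  assumes alpha: "1 < \<alpha>" "\<alpha> \<le> 2"
    and eta: "0 < \<eta>" "\<eta> < 1"
    and beta: "0 < \<beta>"
    and f_cont: "continuous_on ({0..1} \<times> UNIV) (\<lambda>(t, x). f t x)"
    and f_nonneg: "\<And>t x. t \<in> {0..1} \<Longrightarrow> 0 \<le> f t x"
    and H1_compact: "compact_functional H1"
    and H2_compact: "compact_functional H2"
    and H1_nonneg: "\<And>u. u \<in> mspace C01 \<Longrightarrow> 0 \<le> H1 u"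
    and H2_nonneg: "\<And>u. u \<in> mspace C01 \<Longrightarrow> 0 \<le> H2 u"
    and cases:
      "(i = Case1 \<and> \<beta> > max (beta_K \<alpha> \<eta>) (beta_gam \<alpha> \<eta>) \<and> b = 1) \<or>
       (i = Case2 \<and> \<beta> = max (beta_K \<alpha> \<eta>) (beta_gam \<alpha> \<eta>) \<and> b \<in> {\<eta>..<1}) \<or>
       (i = Case3 \<and> \<beta> < min (beta_K \<alpha> \<eta>) (beta_gam \<alpha> \<eta>) \<and> b \<in> {\<eta>..<t_star \<alpha> \<eta> \<beta>})"
    and rho: "0 < \<rho>"
    and delta_lo_cont: "continuous_on {0..b} delta_lo"
    and delta_lo_nonneg: "\<And>t. t \<in> {0..b} \<Longrightarrow> 0 \<le> delta_lo t"
    and f_lower: "\<And>t x. t \<in> {0..b} \<Longrightarrow> x \<in> {sigma_const i \<alpha> \<eta> \<beta> b * \<rho>..\<rho>} \<Longrightarrow> f t x \<ge> delta_lo t"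
    and eta_lo_nonneg: "0 \<le> eta1_lo" "0 \<le> eta2_lo"
    and H_lower: "\<And>u. u \<in> P_cone i \<alpha> \<eta> \<beta> b \<inter> sphere_C01 \<rho> \<Longrightarrow> H1 u \<ge> eta1_lo \<and> H2 u \<ge> eta2_lo"
    and positivity:
      "gam \<alpha> \<eta> \<beta> 0 * eta1_lo + eta2_lo + integral {0..b} (\<lambda>s. K \<alpha> \<eta> \<beta> 0 s * delta_lo s) > 0"
    and eig: "eigenpair \<alpha> \<eta> \<beta> f H1 H2 u\<^sub>\<rho> lam"
    and lam_pos: "0 < lam"
    and u_cone: "u\<^sub>\<rho> \<in> P_cone i \<alpha> \<eta> \<beta> b"
    and u_norm: "supnorm u\<^sub>\<rho> = \<rho>"
    and delta_up_cont: "continuous_on {0..1} delta_up"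
    and delta_up_nonneg: "\<And>t. t \<in> {0..1} \<Longrightarrow> 0 \<le> delta_up t"
    and f_upper: "\<And>t x. t \<in> {0..1} \<Longrightarrow> x \<in> {tau i \<alpha> \<eta> \<beta> b * \<rho>..\<rho>} \<Longrightarrow> f t x \<le> delta_up t"
    and H_upper: "\<And>u. u \<in> P_cone i \<alpha> \<eta> \<beta> b \<inter> sphere_C01 \<rho> \<Longrightarrow> H1 u \<le> eta1_up \<and> H2 u \<le> eta2_up"
  shows "lam \<in>
    {\<rho> / (eta1_up * supnorm (gam \<alpha> \<eta> \<beta>) + eta2_up
            + integral {0..1} (\<lambda>s. Phi i \<alpha> \<eta> \<beta> s * delta_up s))
     .. \<rho> / (eta1_lo * gam \<alpha> \<eta> \<beta> 0 + eta2_lo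
            + integral {0..b} (\<lambda>s. K \<alpha> \<eta> \<beta> 0 s * delta_lo s))}"
proof -
  have b: "0 \<le> b" "b \<le> 1"
  proof -
    have "0 < Gamma (3 - \<alpha>)" using alpha by (intro Gamma_real_pos) simp
    \<comment> \<open>In the third regime \<open>b < t\<^sub>\<gamma>\<close>, and \<open>\<beta> < \<beta>\<^sub>\<gamma>\<close> says exactly that \<open>t\<^sub>\<gamma> < 1\<close>.\<close>
    then have "\<beta> / Gamma (3 - \<alpha>) < 1 - \<eta>" if "\<beta> < beta_gam \<alpha> \<eta>"
      using that by (simp add: beta_gam_def divide_less_eq)
    then show "0 \<le> b" "b \<le> 1" using cases eta by (auto simp: t_star_def)
  qed
  have u_cont: "continuous_on {0..1} u\<^sub>\<rho>" using u_cone by (rule P_cone_continuous)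
  have u_le: "\<bar>u\<^sub>\<rho> t\<bar> \<le> \<rho>" if "t \<in> {0..1}" for t
    using abs_le_supnorm[OF u_cont that] u_norm by simp
  have u_C01: "u\<^sub>\<rho> \<in> mspace C01" using eig by (simp add: eigenpair_def)
  then have u_mem: "u\<^sub>\<rho> \<in> P_cone i \<alpha> \<eta> \<beta> b \<inter> sphere_C01 \<rho>"
    using u_cone u_norm by (simp add: sphere_C01_def)
  have fu_cont: "continuous_on {0..1} (\<lambda>s. f s (u\<^sub>\<rho> s))"
    using f_cont u_cont by (rule continuous_on_superposition)
  have Kf_cont: "continuous_on {0..1} (\<lambda>s. K \<alpha> \<eta> \<beta> t s * f s (u\<^sub>\<rho> s))" for t
    using alpha by (intro continuous_intros fu_cont continuous_on_K) auto
  then have Kf_int: "(\<lambda>s. K \<alpha> \<eta> \<beta> t s * f s (u\<^sub>\<rho> s)) integrable_on {0..1}" for t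
    by (rule integrable_continuous_real)

  let ?lo = "eta1_lo * gam \<alpha> \<eta> \<beta> 0 + eta2_lo + integral {0..b} (\<lambda>s. K \<alpha> \<eta> \<beta> 0 s * delta_lo s)"
  let ?up = "eta1_up * supnorm (gam \<alpha> \<eta> \<beta>) + eta2_up
    + integral {0..1} (\<lambda>s. Phi i \<alpha> \<eta> \<beta> s * delta_up s)"

  have "lam * ?lo \<le> \<rho>"
  proof -
    have "integral {0..b} (\<lambda>s. K \<alpha> \<eta> \<beta> 0 s * delta_lo s)
        \<le> integral {0..b} (\<lambda>s. K \<alpha> \<eta> \<beta> 0 s * f s (u\<^sub>\<rho> s))"
    proof (rule integral_le)
      show "(\<lambda>s. K \<alpha> \<eta> \<beta> 0 s * delta_lo s) integrable_on {0..b}"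
        using alpha by (intro integrable_continuous_real continuous_intros continuous_on_K
            delta_lo_cont) auto
      show "(\<lambda>s. K \<alpha> \<eta> \<beta> 0 s * f s (u\<^sub>\<rho> s)) integrable_on {0..b}"
        by (rule integrable_on_subinterval[OF Kf_int]) (use b in auto)
      fix s assume s: "s \<in> {0..b}"
      have "u\<^sub>\<rho> s \<in> {sigma_const i \<alpha> \<eta> \<beta> b * \<rho>..\<rho>}"
        using P_cone_value_ge[OF u_cone b(2) s] u_norm u_le[of s] s b by auto
      then have "delta_lo s \<le> f s (u\<^sub>\<rho> s)" using f_lower s by blast
      then show "K \<alpha> \<eta> \<beta> 0 s * delta_lo s \<le> K \<alpha> \<eta> \<beta> 0 s * f s (u\<^sub>\<rho> s)"
        using s alpha beta by (intro mult_left_mono K_0_nonneg) auto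
    qed
    also have "\<dots> \<le> integral {0..1} (\<lambda>s. K \<alpha> \<eta> \<beta> 0 s * f s (u\<^sub>\<rho> s))"
      using b alpha beta
      by (intro integral_subset_le integrable_on_subinterval[OF Kf_int] Kf_int)
         (auto intro!: mult_nonneg_nonneg K_0_nonneg f_nonneg)
    finally have int_ge: "integral {0..b} (\<lambda>s. K \<alpha> \<eta> \<beta> 0 s * delta_lo s) \<le> \<dots>" .
    have "0 < Gamma (3 - \<alpha>)" using alpha by (intro Gamma_real_pos) simp
    then have "0 \<le> gam \<alpha> \<eta> \<beta> 0" using beta eta by (simp add: gam_def)
    then have "eta1_lo * gam \<alpha> \<eta> \<beta> 0 \<le> H1 u\<^sub>\<rho> * gam \<alpha> \<eta> \<beta> 0"
      using H_lower[OF u_mem] by (intro mult_right_mono) auto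
    then have "lam * ?lo \<le> u\<^sub>\<rho> 0"
      unfolding eigenpair_value[OF eig, of 0, simplified]
      using int_ge H_lower[OF u_mem] lam_pos by (intro mult_left_mono) auto
    then show ?thesis using u_le[of 0] by simp
  qed
  moreover have "0 < ?lo" using positivity by (simp add: mult.commute)
  ultimately have le_U: "lam \<le> \<rho> / ?lo" by (simp add: pos_le_divide_eq)

  have "\<bar>u\<^sub>\<rho> t\<bar> \<le> lam * ?up" if t: "t \<in> {0..1}" for t
  proof -
    have "\<bar>integral {0..1} (\<lambda>s. K \<alpha> \<eta> \<beta> t s * f s (u\<^sub>\<rho> s))\<bar>
        \<le> integral {0..1} (\<lambda>s. Phi i \<alpha> \<eta> \<beta> s * delta_up s)"
      unfolding real_norm_def[symmetric]
    proof (rule integral_norm_bound_integral[OF Kf_int])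
      have "continuous_on {0..1} (Phi i \<alpha> \<eta> \<beta>)"
        by (cases i) simp_all
      then show "(\<lambda>s. Phi i \<alpha> \<eta> \<beta> s * delta_up s) integrable_on {0..1}"
        by (intro integrable_continuous_real continuous_intros delta_up_cont)
      fix s :: real assume s: "s \<in> {0..1}"
      have K: "\<bar>K \<alpha> \<eta> \<beta> t s\<bar> \<le> Phi i \<alpha> \<eta> \<beta> s"
        using alpha eta t s cases by (intro abs_K_le_Phi) auto
      have "u\<^sub>\<rho> s \<in> {tau i \<alpha> \<eta> \<beta> b * \<rho>..\<rho>}"
        using P_cone_value_ge_tau[OF u_cone s] u_norm u_le[OF s] by auto
      then have "f s (u\<^sub>\<rho> s) \<le> delta_up s" using f_upper s by blast
      then show "norm (K \<alpha> \<eta> \<beta> t s * f s (u\<^sub>\<rho> s)) \<le> Phi i \<alpha> \<eta> \<beta> s * delta_up s"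
        using K f_nonneg[OF s] by (auto simp: abs_mult intro!: mult_mono)
    qed
    moreover have "\<bar>H1 u\<^sub>\<rho> * gam \<alpha> \<eta> \<beta> t\<bar> \<le> eta1_up * supnorm (gam \<alpha> \<eta> \<beta>)"
    proof -
      have "continuous_on {0..1} (gam \<alpha> \<eta> \<beta>)"
        unfolding gam_def by (intro continuous_intros)
      then have "\<bar>gam \<alpha> \<eta> \<beta> t\<bar> \<le> supnorm (gam \<alpha> \<eta> \<beta>)" using t by (rule abs_le_supnorm)
      then show ?thesis
        using H1_nonneg[OF u_C01] H_upper[OF u_mem] by (auto simp: abs_mult intro!: mult_mono)
    qed
    moreover have "\<bar>H2 u\<^sub>\<rho>\<bar> \<le> eta2_up" using H2_nonneg[OF u_C01] H_upper[OF u_mem] by simp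
    ultimately have "\<bar>H1 u\<^sub>\<rho> * gam \<alpha> \<eta> \<beta> t + H2 u\<^sub>\<rho>
        + integral {0..1} (\<lambda>s. K \<alpha> \<eta> \<beta> t s * f s (u\<^sub>\<rho> s))\<bar> \<le> ?up"
      by linarith
    then show ?thesis
      unfolding eigenpair_value[OF eig t] using lam_pos by (simp add: abs_mult)
  qed
  then have le_up: "\<rho> \<le> lam * ?up"
    unfolding u_norm[symmetric] by (rule supnorm_le)
  \<comment> \<open>The sign of the denominator of \<open>L(\<rho>)\<close> comes from this very inequality, as \<open>\<rho>\<close> and
    \<open>\<lambda>\<close> are positive.\<close>
  then have "0 < lam * ?up" using rho by linarith
  then have "0 < ?up" using lam_pos by (simp add: zero_less_mult_iff)
  then have "\<rho> / ?up \<le> lam" using le_up by (simp add: pos_divide_le_eq)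
  then show ?thesis using le_U by simp
qed

end
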